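(* Let $(X_k)_{k\ge1}$ be a sequence of independent centered random variables with cumulative distribution functions $(F_k)_{k\ge1}$, and suppose that the function $$f_1(t):=\sum_{k=1}^\infty F_k^{-1}\Big(\frac t2-(k-1)\Big)\mathbf 1_{[2k-2,2k)}(t),\qquad t\in\mathbb R_+,$$ belongs to $\mathcal C^1_\Box(\mathbb R_+)\cap L^2(\mathbb R_+)$. Then for every $n\ge1$ the sum $Z_n:=\sum_{k=1}^nX_k$ satisfies $$d_W(Z_n,\mathcal N)\le|1-\mathbb E[Z_n^2]|+\sum_{k=1}^n\mathbb E[|X_k|^3]+\sum_{k=1}^n\mathbb E[|X_k|]\,\mathbb E[|X_k|^2].$$
   Context: $\mathbb R_+=[0,\infty)$. $F_k^{-1}(t):=\inf\{s\in\mathbb R:F_k(s)\ge t\}$ is the generalized inverse of $F_k$. $\mathcal C^1_\Box(\mathbb R_+)$ is the set of functions that are $\mathcal C^1$ on every interval $(2k,2k+2)$, $k\in\{0,1,2,\ldots\}$. In terms of i.i.d. random variables $U_0,U_1,\ldots$ uniform on $[-1,1]$, $X_k$ has the law of $f_1(2(k-1)+1+U_{k-1})$, and $Z_n$ has the law of the single stochastic integral $I_1(f_1\mathbf 1_{[0,2n]})=\sum_{k=0}^{n-1}f_1(2k+1+U_k)$. $\mathcal N$ is a standard normal random variable, and $d_W(X,Y)=\sup_h|\mathbb E[h(X)]-\mathbb E[h(Y)]|$ over Lipschitz $h:\mathbb R\to\mathbb R$ with constant at most $1$. The right-hand side may be $+\infty$. *)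

theory Defs
  imports "HOL-Probability.Probability"
begin

text \<open>
  If \<open>F\<close> is a distribution function and \<open>0 < t < 1\<close>, the set below is nonempty and bounded below, so
  the infimum is the usual generalized inverse.  For \<open>t \<le> 0\<close> the mathematical value is \<open>-\<infinity>\<close>, whereas
  the real-valued \<open>Inf UNIV\<close> is an unspecified number.
\<close>
definition gen_inverse :: "(real \<Rightarrow> real) \<Rightarrow> real \<Rightarrow> real" where
  "gen_inverse F t = Inf {s. F s \<ge> t}"

text \<open>
  For every \<open>t\<close> at most one summand is nonzero.  The unspecified values of \<^const>\<open>gen_inverse\<close> enter
  only at the left endpoints \<open>t = 2 * (k - 1)\<close>, a null set disjoint from all the open intervals
  \<open>(2 * k, 2 * k + 2)\<close>.
\<close>
definition quantile_step_fun :: "(nat \<Rightarrow> real \<Rightarrow> real) \<Rightarrow> real \<Rightarrow> real" where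
  "quantile_step_fun F t =
     (\<Sum>\<^sub>\<infinity>k\<in>{1::nat..}. gen_inverse (F k) (t / 2 - (real k - 1)) *
                        indicator {2 * real k - 2..<2 * real k} t)"

definition C1_box :: "(real \<Rightarrow> real) set" where
  "C1_box = {f. \<forall>k::nat. f C1_differentiable_on {2 * real k<..<2 * real k + 2}}"

definition L2_halfline :: "(real \<Rightarrow> real) set" where
  "L2_halfline = {f. set_borel_measurable lebesgue {0..} f \<and>
                     set_integrable lebesgue {0..} (\<lambda>t. (f t)\<^sup>2)}"

text \<open>
  The two random variables may live on different probability spaces.  They are meant to be integrable,
  in which case \<open>h \<circ> X\<close> and \<open>h \<circ> Y\<close> are integrable for every Lipschitz \<open>h\<close>.
\<close>
definition wasserstein_dist ::
  "'a measure \<Rightarrow> ('a \<Rightarrow> real) \<Rightarrow> 'b measure \<Rightarrow> ('b \<Rightarrow> real) \<Rightarrow> ennreal" where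
  "wasserstein_dist M X N Y =
     (SUP h\<in>{h :: real \<Rightarrow> real. 1-lipschitz_on UNIV h}.
        ennreal \<bar>(\<integral>\<omega>. h (X \<omega>) \<partial>M) - (\<integral>\<omega>. h (Y \<omega>) \<partial>N)\<bar>)"

end

theory Submission
  imports Defs "HOL-Real_Asymp.Real_Asymp"
begin

text \<open>
  Stein's method.  For a 1-Lipschitz \<open>h\<close> let \<open>f\<close> solve \<open>f' x = x f x + h x - E h(N)\<close>, so that
  \<open>E h(W) - E h(N) = E (f' W - W f W)\<close> for \<open>W = X\<^sub>1 + \<dots> + X\<^sub>n\<close>.  Explicit Gaussian tail identities
  give \<open>\<bar>f'\<bar> \<le> 1\<close> and \<open>\<bar>(x f x)'\<bar> \<le> 1\<close>, hence \<open>f'\<close> is 2-Lipschitz, without any smoothing of \<open>h\<close>.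
  Conditioning on \<open>W - X\<^sub>k\<close> reduces the estimate to a single centered variable \<open>X\<close>.  With an
  independent copy \<open>Y\<close>, the difference \<open>E X f(X) - E X\<^sup>2 E f'(X)\<close> is half the expectation of
  \<open>(X - Y) (f X - f Y + Y f' X - X f' Y)\<close>, and the second factor is the difference of the first order
  Taylor remainders of \<open>f\<close> at \<open>Y\<close> and at \<open>X\<close>, both evaluated at \<open>X + Y\<close>.  This symmetrization is what
  yields the constant 1 in front of \<open>E \<bar>X\<bar> E X\<^sup>2\<close>.  If some third moment is infinite, so is the bound.
\<close>

section \<open>Integrals over half-lines and the fundamental theorem of calculus\<close>

lemma set_integrable_of_integrable:
  fixes g :: "real \<Rightarrow> real"
  assumes "integrable lborel g" "S \<in> sets borel"
  shows "set_integrable lborel S g"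
  using assms by (intro set_integrable_subset[where A=UNIV and B=S]) (auto simp: set_integrable_def)

lemma has_real_derivative_integral_atMost:
  fixes g :: "real \<Rightarrow> real"
  assumes cont: "continuous_on UNIV g" and int: "integrable lborel g"
  shows "((\<lambda>x. LBINT t:{..x}. g t) has_real_derivative g x) (at x)"
proof -
  note si = set_integrable_of_integrable[OF int]
  \<comment> \<open>The base point \<open>x - 1\<close> lies strictly to the left of
    \<open>x\<close>, so this splitting into a constant and an integral over a compact interval
    holds on a whole neighbourhood of \<open>x\<close> and a two-sided derivative can be
    transferred.\<close>
  have eq: "(LBINT t:{..y}. g t) = (LBINT t:{..x-1}. g t) + integral {x-1..y} g"
    if "y \<in> {x-1<..}" for y
  proof -
    have "{..y} = {..x-1} \<union> {x-1<..y}" using that by auto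
    then have "(LBINT t:{..y}. g t) = (LBINT t:{..x-1}. g t) + (LBINT t:{x-1<..y}. g t)"
      by (simp add: set_integral_Un[OF _ si si] ivl_disj_int)
    also have "(LBINT t:{x-1<..y}. g t) = (LBINT t:{x-1..y}. g t)"
      using borel_measurable_continuous_onI[OF cont]
      by (intro set_integral_cong_set) (auto simp: set_borel_measurable_def intro!: AE_I[where N="{x-1}"]
        borel_measurable_times)
    also have "\<dots> = integral {x-1..y} g"
      by (intro set_borel_integral_eq_integral si) auto
    finally show ?thesis .
  qed
  have "((\<lambda>y. (LBINT t:{..x-1}. g t) + integral {x-1..y} g) has_real_derivative 0 + g x)
     (at x within {x-1..x+1})"
    by (intro DERIV_add DERIV_const integral_has_real_derivative continuous_on_subset[OF cont]) auto
  then have "((\<lambda>y. (LBINT t:{..x-1}. g t) + integral {x-1..y} g) has_real_derivative g x) (at x)"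
    by (simp add: at_within_Icc_at)
  then show ?thesis
    by (rule DERIV_cong_ev[THEN iffD1, rotated -1])
      (auto simp: eventually_nhds eq intro!: exI[of _ "{x-1<..}"])
qed

text \<open>The fundamental theorem on \<open>{a..x}\<close>, followed by the limit of
  \<open>a\<close> to minus infinity, where the boundary term vanishes by
  \<open>lim\<close>.\<close>

lemma integral_atMost_FTC:
  fixes F g :: "real \<Rightarrow> real"
  assumes "\<And>x. (F has_real_derivative g x) (at x)" "continuous_on UNIV g" "integrable lborel g"
    and lim: "(F \<longlongrightarrow> 0) at_bot"
  shows "(LBINT t:{..x}. g t) = F x"
proof -
  note si = set_integrable_of_integrable[OF assms(3)]
  have "((\<lambda>a. LBINT t:{a..x}. g t) \<longlongrightarrow> (LBINT t:{..x}. g t)) at_bot"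
    by (intro tendsto_set_lebesgue_integral_at_bot si) auto
  moreover have "((\<lambda>a. LBINT t:{a..x}. g t) \<longlongrightarrow> F x - 0) at_bot"
  proof (rule Lim_transform_eventually)
    show "((\<lambda>a. F x - F a) \<longlongrightarrow> F x - 0) at_bot" by (intro tendsto_intros lim)
    show "\<forall>\<^sub>F a in at_bot. F x - F a = (LBINT t:{a..x}. g t)"
      using eventually_le_at_bot[of x]
    proof eventually_elim
      case (elim a)
      then show ?case unfolding set_lebesgue_integral_def
        using integral_FTC_Icc_real[of a x F g] assms(1,2)
        by (simp add: continuous_on_eq_continuous_at has_real_derivative_iff_has_vector_derivative mult.commute)
    qed
  qed
  ultimately show ?thesis
    using tendsto_unique[OF trivial_limit_at_bot_linorder] by fastforce
qed

section \<open>The Gaussian density, its tails and its truncated moments\<close>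

lemma DERIV_std_normal_density:
  "(std_normal_density has_real_derivative - x * std_normal_density x) (at x)"
proof -
  have "((\<lambda>x. c * exp (- x\<^sup>2 / 2)) has_real_derivative - x * (c * exp (- x\<^sup>2 / 2))) (at x)" for c
    by (auto intro!: derivative_eq_intros)
  then show ?thesis unfolding std_normal_density_def .
qed

lemma continuous_on_std_normal_density: "continuous_on S std_normal_density"
  unfolding std_normal_density_def by (intro continuous_intros) auto

lemma std_normal_density_at_bot: "(std_normal_density \<longlongrightarrow> 0) at_bot"
  unfolding std_normal_density_def by real_asymp

lemma mult_std_normal_density_at_bot: "((\<lambda>x. - x * std_normal_density x) \<longlongrightarrow> 0) at_bot"
  unfolding std_normal_density_def by real_asymp

lemma std_normal_density_pos: "std_normal_density x > 0"
  by (simp add: normal_density_pos)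

definition lower_tail :: "real \<Rightarrow> real" where
  "lower_tail x = (LBINT t:{..x}. std_normal_density t)"

definition upper_tail :: "real \<Rightarrow> real" where
  "upper_tail x = (LBINT t:{x<..}. std_normal_density t)"

lemma integral_atMost_add_greaterThan:
  fixes g :: "real \<Rightarrow> real"
  assumes "integrable lborel g"
  shows "(LBINT t:{..x}. g t) + (LBINT t:{x<..}. g t) = (LBINT t. g t)"
proof -
  have "UNIV = {..x} \<union> {x<..}" by auto
  then have "(LBINT t:UNIV. g t) = (LBINT t:{..x}. g t) + (LBINT t:{x<..}. g t)"
    using set_integral_Un[OF _ set_integrable_of_integrable set_integrable_of_integrable, of "{..x}" "{x<..}" g]
      assms by (simp add: Int_def)
  then show ?thesis by (simp add: set_lebesgue_integral_def)
qed

lemma integrable_density_monomials: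
  "integrable lborel std_normal_density"
  "integrable lborel (\<lambda>t. t * std_normal_density t)"
  "integrable lborel (\<lambda>t. t\<^sup>2 * std_normal_density t)"
  using integrable_std_normal_moment[of 0] integrable_std_normal_moment[of 1] integrable_std_normal_moment[of 2]
  by (simp_all add: mult.commute)

lemma integral_density_monomials:
  "(LBINT t. std_normal_density t) = 1"
  "(LBINT t. t * std_normal_density t) = 0"
  "(LBINT t. t\<^sup>2 * std_normal_density t) = 1"
  using integral_std_normal_moment_even[of 0] integral_std_normal_moment_odd[of 0] integral_std_normal_moment_even[of 1]
  by (simp_all add: mult.commute fact_2)

lemma lower_add_upper_tail: "lower_tail x + upper_tail x = 1"
  unfolding lower_tail_def upper_tail_def
  by (simp add: integral_atMost_add_greaterThan integrable_density_monomials integral_density_monomials)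

lemma DERIV_lower_tail: "(lower_tail has_real_derivative std_normal_density x) (at x)"
  unfolding lower_tail_def
  by (intro has_real_derivative_integral_atMost continuous_on_std_normal_density integrable_density_monomials)

lemma DERIV_upper_tail: "(upper_tail has_real_derivative - std_normal_density x) (at x)"
proof -
  have "upper_tail = (\<lambda>x. 1 - lower_tail x)" using lower_add_upper_tail by (auto simp: algebra_simps)
  then show ?thesis using DERIV_diff[OF DERIV_const DERIV_lower_tail[of x], of 1] by simp
qed

lemma tail_nonneg: "lower_tail x \<ge> 0" "upper_tail x \<ge> 0"
  unfolding lower_tail_def upper_tail_def set_lebesgue_integral_def
  by (auto intro!: integral_nonneg_AE)

text \<open>The negated density is the antiderivative of the integrand that vanishes at minus
  infinity.\<close>

lemma lower_tail_moment1: "(LBINT t:{..x}. t * std_normal_density t) = - std_normal_density x"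
proof -
  have "((\<lambda>x. - std_normal_density x) \<longlongrightarrow> - 0) at_bot" by (intro tendsto_intros std_normal_density_at_bot)
  then show ?thesis
    by (intro integral_atMost_FTC integrable_density_monomials continuous_intros continuous_on_std_normal_density)
      (auto intro!: derivative_eq_intros DERIV_std_normal_density)
qed

text \<open>The function \<open>- x * std_normal_density x\<close> has derivative
  \<open>(x\<^sup>2 - 1) * std_normal_density x\<close>, so the second moment minus the zeroth one
  is a pure boundary term.\<close>

lemma lower_tail_moment2: "(LBINT t:{..x}. t\<^sup>2 * std_normal_density t) = lower_tail x - x * std_normal_density x"
proof -
  have "(LBINT t:{..x}. (t\<^sup>2 * std_normal_density t - std_normal_density t)) = - x * std_normal_density x"
    by (intro integral_atMost_FTC Bochner_Integration.integrable_diff integrable_density_monomials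
       continuous_intros continuous_on_std_normal_density mult_std_normal_density_at_bot)
      (auto intro!: derivative_eq_intros DERIV_std_normal_density simp: power2_eq_square)
  moreover have "(LBINT t:{..x}. (t\<^sup>2 * std_normal_density t - std_normal_density t)) =
     (LBINT t:{..x}. t\<^sup>2 * std_normal_density t) - lower_tail x"
    unfolding lower_tail_def
    by (intro set_integral_diff set_integrable_of_integrable integrable_density_monomials) auto
  ultimately show ?thesis by simp
qed

lemma upper_tail_moment1: "(LBINT t:{x<..}. t * std_normal_density t) = std_normal_density x"
  using integral_atMost_add_greaterThan[OF integrable_density_monomials(2), of x]
  by (simp add: lower_tail_moment1 integral_density_monomials)

lemma upper_tail_moment2: "(LBINT t:{x<..}. t\<^sup>2 * std_normal_density t) = upper_tail x + x * std_normal_density x"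
  using integral_atMost_add_greaterThan[OF integrable_density_monomials(3), of x] lower_add_upper_tail[of x]
  by (simp add: lower_tail_moment2 integral_density_monomials)

section \<open>Tail inequalities obtained from nonnegative quadratic polynomials\<close>

lemma lower_tail_quadratic_nonneg:
  assumes "\<And>t. t \<le> x \<Longrightarrow> 0 \<le> a + b * t + c * t\<^sup>2"
  shows "0 \<le> a * lower_tail x - b * std_normal_density x + c * (lower_tail x - x * std_normal_density x)"
proof -
  have "0 \<le> (LBINT t:{..x}. (a + b * t + c * t\<^sup>2) * std_normal_density t)"
    unfolding set_lebesgue_integral_def using assms by (auto intro!: integral_nonneg_AE simp: indicator_def)
  also have "\<dots> = (LBINT t:{..x}. a * std_normal_density t + b * (t * std_normal_density t) + c * (t\<^sup>2 * std_normal_density t))"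
    by (simp add: algebra_simps)
  also have "\<dots> = a * lower_tail x + b * (LBINT t:{..x}. t * std_normal_density t) + c * (LBINT t:{..x}. t\<^sup>2 * std_normal_density t)"
    unfolding lower_tail_def
    by (simp add: set_integral_add set_integrable_of_integrable integrable_density_monomials set_integral_mult_right)
  finally show ?thesis by (simp add: lower_tail_moment1 lower_tail_moment2)
qed

text \<open>As for the lower tail, a polynomial that is nonnegative on the half-line is integrated
  against the density, and the truncated moments turn the result into an inequality between tail and
  density. The nonnegativity of the excesses and the bound on their sum below are choices of this
  polynomial.\<close>

lemma upper_tail_quadratic_nonneg:
  assumes "\<And>t. t \<ge> x \<Longrightarrow> 0 \<le> a + b * t + c * t\<^sup>2"
  shows "0 \<le> a * upper_tail x + b * std_normal_density x + c * (upper_tail x + x * std_normal_density x)"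
proof -
  have "0 \<le> (LBINT t:{x<..}. (a + b * t + c * t\<^sup>2) * std_normal_density t)"
    unfolding set_lebesgue_integral_def using assms by (auto intro!: integral_nonneg_AE simp: indicator_def)
  also have "\<dots> = (LBINT t:{x<..}. a * std_normal_density t + b * (t * std_normal_density t) + c * (t\<^sup>2 * std_normal_density t))"
    by (simp add: algebra_simps)
  also have "\<dots> = a * upper_tail x + b * (LBINT t:{x<..}. t * std_normal_density t) + c * (LBINT t:{x<..}. t\<^sup>2 * std_normal_density t)"
    unfolding upper_tail_def
    by (simp add: set_integral_add set_integrable_of_integrable integrable_density_monomials set_integral_mult_right)
  finally show ?thesis by (simp add: upper_tail_moment1 upper_tail_moment2)
qed

text \<open>For a standard normal variable \<open>N\<close>, \<open>lower_excess x\<close> is the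
  expectation of the positive part of \<open>x - N\<close>, and \<open>upper_excess x\<close> is
  that of \<open>N - x\<close>.\<close>

definition lower_excess :: "real \<Rightarrow> real" where
  "lower_excess x = x * lower_tail x + std_normal_density x"

definition upper_excess :: "real \<Rightarrow> real" where
  "upper_excess x = std_normal_density x - x * upper_tail x"

lemma excess_nonneg: "lower_excess x \<ge> 0" "upper_excess x \<ge> 0"
  using lower_tail_quadratic_nonneg[of x x "-1" 0] upper_tail_quadratic_nonneg[of x "-x" 1 0]
  by (simp_all add: lower_excess_def upper_excess_def)

text \<open>These are the integrals of \<open>(x - t)\<^sup>2\<close> against the density over the
  two half-lines. They serve as the weights when the derivative of
  \<open>x * stein_solution x\<close> is bounded.\<close>

lemma second_excess_nonneg:
  "(1 + x\<^sup>2) * lower_tail x + x * std_normal_density x \<ge> 0"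
  "(1 + x\<^sup>2) * upper_tail x - x * std_normal_density x \<ge> 0"
proof -
  have sq: "0 \<le> x\<^sup>2 + (-2*x) * t + 1 * t\<^sup>2" for t
    using zero_le_power2[of "x - t"] by (simp add: power2_diff)
  show "(1 + x\<^sup>2) * lower_tail x + x * std_normal_density x \<ge> 0"
    using lower_tail_quadratic_nonneg[OF sq, of x] by (simp add: algebra_simps)
  show "(1 + x\<^sup>2) * upper_tail x - x * std_normal_density x \<ge> 0"
    using upper_tail_quadratic_nonneg[OF sq, of x] by (simp add: algebra_simps)
qed

text \<open>The left side is the mean of \<open>\<bar>x - N\<bar>\<close> for a standard normal
  \<open>N\<close>. Integrating \<open>\<bar>u\<bar> \<le> (1 + u\<^sup>2) / 2\<close> at
  \<open>u = x - t\<close> gives the claim; the two polynomials correspond to the two signs of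
  \<open>u\<close>.\<close>

lemma excess_sum_le: "lower_excess x + upper_excess x \<le> 1 + x\<^sup>2 / 2"
proof -
  have 1: "0 \<le> ((1+x\<^sup>2)/2 - x) + (1 - x) * t + (1/2) * t\<^sup>2" for t
    using zero_le_power2[of "1 - (x - t)"] by (simp add: power2_eq_square field_simps)
  have 2: "0 \<le> ((1+x\<^sup>2)/2 + x) + (- 1 - x) * t + (1/2) * t\<^sup>2" for t
    using zero_le_power2[of "1 + (x - t)"] by (simp add: power2_eq_square field_simps)
  have u: "upper_tail x = 1 - lower_tail x" using lower_add_upper_tail[of x] by simp
  show ?thesis
    using lower_tail_quadratic_nonneg[OF 1, of x] upper_tail_quadratic_nonneg[OF 2, of x]
    unfolding lower_excess_def upper_excess_def u
    by (simp add: field_simps)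
qed

lemma std_normal_density_le: "std_normal_density x \<le> 1/2"
proof -
  have "2 \<le> sqrt (2 * pi)" using pi_gt3 by (intro real_le_rsqrt) simp
  moreover have "exp (- x\<^sup>2 / 2) \<le> 1" by simp
  ultimately have "exp (- x\<^sup>2 / 2) / sqrt (2 * pi) \<le> 1 / 2"
    by (intro frac_le) auto
  then show ?thesis by (simp add: std_normal_density_def)
qed

text \<open>
  With \<open>l\<close>, \<open>r\<close> the two excesses and \<open>\<phi>\<close> the density, \<open>(l r - \<phi> / 2) / x\<^sup>2\<close> has derivative
  \<open>\<phi> (1 + x\<^sup>2 / 2 - (l + r)) / x\<^sup>3 \<ge> 0\<close> and tends to \<open>0\<close> at infinity.
\<close>
lemma excess_prod_le_pos:
  assumes "x > 0"
  shows "2 * lower_excess x * upper_excess x \<le> std_normal_density x"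
proof -
  define H where "H = (\<lambda>x. (lower_excess x * upper_excess x - std_normal_density x / 2) / x\<^sup>2)"
  have DH: "(H has_real_derivative
       std_normal_density y * (1 + y\<^sup>2 / 2 - (lower_excess y + upper_excess y)) / y^3) (at y)" if "y > 0" for y
  proof -
    have u: "upper_tail y = 1 - lower_tail y" using lower_add_upper_tail[of y] by simp
    have D: "(lower_excess has_real_derivative lower_tail y) (at y)"
      "(upper_excess has_real_derivative - upper_tail y) (at y)"
      unfolding lower_excess_def[abs_def] upper_excess_def[abs_def]
      by (auto intro!: derivative_eq_intros DERIV_std_normal_density DERIV_lower_tail DERIV_upper_tail)
    have "((\<lambda>x. lower_excess x * upper_excess x - std_normal_density x / 2) has_real_derivative
        lower_tail y * upper_excess y - upper_tail y * lower_excess y + y * std_normal_density y / 2) (at y)"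
      by (auto intro!: derivative_eq_intros D DERIV_std_normal_density)
    moreover have "((\<lambda>x. x\<^sup>2) has_real_derivative 2 * y) (at y)"
      by (auto intro!: derivative_eq_intros)
    ultimately show ?thesis unfolding H_def using that
      apply (intro DERIV_cong[OF DERIV_divide])
         apply assumption+
       apply simp
      unfolding lower_excess_def upper_excess_def u
      by (simp add: field_simps power2_eq_square power3_eq_cube)
  qed
  have mono: "H x \<le> H y" if "x \<le> y" for y
  proof (rule DERIV_nonneg_imp_nondecreasing[OF that])
    fix z assume "x \<le> z" "z \<le> y"
    then have "z > 0" using assms by simp
    then show "\<exists>d. (H has_real_derivative d) (at z) \<and> 0 \<le> d"
      using DH excess_sum_le[of z] by (force intro: divide_nonneg_nonneg mult_nonneg_nonneg)
  qed
  \<comment> \<open>Since \<open>H\<close> is nondecreasing from \<open>x\<close> on, any majorant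
    tending to 0 at infinity is enough. The crude bounds \<open>y + 1\<close> and \<open>1\<close>
    on the excesses suffice because of the division by \<open>y\<^sup>2\<close>.\<close>
  have le: "H x \<le> (y + 1) / y\<^sup>2" if "x \<le> y" for y
  proof -
    have y: "y > 0" using that assms by simp
    have "y * lower_tail y \<le> y * 1"
      using y tail_nonneg(2)[of y] lower_add_upper_tail[of y] by (intro mult_left_mono) auto
    then have "lower_excess y \<le> y + 1" "upper_excess y \<le> 1"
      using y tail_nonneg(2)[of y] mult_nonneg_nonneg[of y "upper_tail y"] std_normal_density_le[of y]
      unfolding lower_excess_def upper_excess_def by linarith+
    then have "lower_excess y * upper_excess y \<le> (y + 1) * 1"
      using y excess_nonneg[of y] by (intro mult_mono) auto
    then have "H y \<le> (y + 1) / y\<^sup>2"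
      using std_normal_density_pos[of y] unfolding H_def by (intro divide_right_mono) auto
    with mono[OF that] show ?thesis by simp
  qed
  have "((\<lambda>y. (y + 1) / y\<^sup>2) \<longlongrightarrow> (0::real)) at_top" by real_asymp
  then have "H x \<le> 0"
    by (rule tendsto_lowerbound) (auto intro: eventually_at_top_linorderI[of x] le)
  then show ?thesis using assms unfolding H_def by (simp add: divide_le_0_iff zero_less_mult_iff)
qed

lemma lower_tail_uminus: "lower_tail (- x) = upper_tail x"
proof -
  have "lower_tail (-x) = (LBINT t:{x..}. std_normal_density t)"
    unfolding lower_tail_def set_lebesgue_integral_def
    by (subst lborel_integral_real_affine[where t=0 and c="-1"])
      (auto simp: indicator_def std_normal_density_def intro!: Bochner_Integration.integral_cong)
  also have "\<dots> = upper_tail x" unfolding upper_tail_def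
    by (rule set_integral_cong_set) (auto simp: set_borel_measurable_def intro!: AE_I[where N="{x}"])
  finally show ?thesis .
qed

text \<open>Reflection at 0 swaps the two excesses and preserves the density, which reduces negative
  \<open>x\<close> to positive \<open>x\<close>. At 0 both excesses equal the density, and the claim
  is that the density is at most 1/2 there.\<close>

lemma excess_prod_le: "2 * lower_excess x * upper_excess x \<le> std_normal_density x"
proof (rule linorder_cases[of x 0])
  assume "x < 0"
  have "std_normal_density (- x) = std_normal_density x" by (simp add: std_normal_density_def)
  moreover have "upper_tail (- x) = lower_tail x" using lower_tail_uminus[of "-x"] by simp
  ultimately have "lower_excess (- x) = upper_excess x" "upper_excess (- x) = lower_excess x"
    by (auto simp: lower_excess_def upper_excess_def lower_tail_uminus)
  with excess_prod_le_pos[of "-x"] \<open>x < 0\<close> \<open>std_normal_density (- x) = _\<close> show ?thesis by (simp add: mult_ac)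
next
  assume "x = 0"
  then show ?thesis
    using mult_left_mono[OF std_normal_density_le[of 0], of "2 * std_normal_density 0"] std_normal_density_pos[of 0]
    by (simp add: lower_excess_def upper_excess_def mult_ac)
qed (rule excess_prod_le_pos)

section \<open>The Stein equation for a 1-Lipschitz function and bounds on its solution\<close>

lemma abs_linear_combination_le:
  fixes a b L R l r :: real
  assumes "\<bar>L\<bar> \<le> l" "\<bar>R\<bar> \<le> r" "a \<ge> 0" "b \<ge> 0"
  shows "\<bar>L * a - R * b\<bar> \<le> l * a + r * b" "\<bar>L * a + R * b\<bar> \<le> l * a + r * b"
proof -
  have "\<bar>L * a\<bar> \<le> l * a" "\<bar>R * b\<bar> \<le> r * b" using assms by (auto simp: abs_mult intro!: mult_right_mono)
  then show "\<bar>L * a - R * b\<bar> \<le> l * a + r * b" "\<bar>L * a + R * b\<bar> \<le> l * a + r * b" by linarith+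
qed

context
  fixes h :: "real \<Rightarrow> real"
  assumes lip: "1-lipschitz_on UNIV h"
begin

lemma lipschitz_diff_le: "\<bar>h t - h x\<bar> \<le> \<bar>t - x\<bar>"
  using lipschitz_onD[OF lip, of t x] by (simp add: dist_real_def)

lemma continuous_lipschitz: "continuous_on S h"
  using lipschitz_on_continuous_on[OF lip] continuous_on_subset by blast

text \<open>The centering constant stays arbitrary because three values occur: the Gaussian mean of
  \<open>h\<close>, the value \<open>h x\<close>, and 0. Linear growth of \<open>h\<close> gives the
  dominating function.\<close>

lemma integrable_lipschitz_density: "integrable lborel (\<lambda>t. (h t - c) * std_normal_density t)"
proof (rule Bochner_Integration.integrable_bound)
  show "integrable lborel (\<lambda>t. (\<bar>h 0\<bar> + \<bar>c\<bar>) * std_normal_density t + std_normal_density t * \<bar>t\<bar> ^ 1)"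
    by (intro Bochner_Integration.integrable_add integrable_mult_right integrable_density_monomials
       integrable_std_normal_moment_abs)
  show "(\<lambda>t. (h t - c) * std_normal_density t) \<in> borel_measurable lborel"
    using borel_measurable_continuous_onI[OF continuous_lipschitz] by measurable
  show "AE t in lborel. norm ((h t - c) * std_normal_density t) \<le>
     norm ((\<bar>h 0\<bar> + \<bar>c\<bar>) * std_normal_density t + std_normal_density t * \<bar>t\<bar> ^ 1)"
  proof (rule AE_I2)
    fix t
    have "\<bar>h t - c\<bar> \<le> \<bar>h 0\<bar> + \<bar>c\<bar> + \<bar>t\<bar>" using lipschitz_diff_le[of t 0] by linarith
    then have "\<bar>h t - c\<bar> * std_normal_density t \<le> (\<bar>h 0\<bar> + \<bar>c\<bar> + \<bar>t\<bar>) * std_normal_density t"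
      by (intro mult_right_mono) auto
    then show "norm ((h t - c) * std_normal_density t) \<le>
     norm ((\<bar>h 0\<bar> + \<bar>c\<bar>) * std_normal_density t + std_normal_density t * \<bar>t\<bar> ^ 1)"
      by (simp only: abs_mult real_norm_def) (simp add: algebra_simps)
  qed
qed

definition normal_mean :: real where
  "normal_mean = (LBINT t. h t * std_normal_density t)"

text \<open>With the density as integrating factor, the Stein equation says that solution times
  density has derivative \<open>(h t - normal_mean) * std_normal_density t\<close>. Integrating from
  minus infinity selects this solution.\<close>

definition stein_solution :: "real \<Rightarrow> real" where
  "stein_solution x = (LBINT t:{..x}. (h t - normal_mean) * std_normal_density t) / std_normal_density x"

text \<open>Taking the right side of the Stein equation as the definition makes the equation hold by
  unfolding; that it really is the derivative is then a lemma.\<close>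

definition stein_deriv :: "real \<Rightarrow> real" where
  "stein_deriv x = x * stein_solution x + h x - normal_mean"

lemma DERIV_stein_solution: "(stein_solution has_real_derivative stein_deriv x) (at x)"
proof -
  have *: "((\<lambda>x. LBINT t:{..x}. (h t - normal_mean) * std_normal_density t) has_real_derivative
     (h x - normal_mean) * std_normal_density x) (at x)"
    by (intro has_real_derivative_integral_atMost integrable_lipschitz_density
      continuous_intros continuous_lipschitz continuous_on_std_normal_density)
  have nz: "std_normal_density x \<noteq> 0" using std_normal_density_pos[of x] by simp
  show ?thesis
    unfolding stein_solution_def[abs_def]
    apply (rule DERIV_cong[OF DERIV_divide[OF * DERIV_std_normal_density nz]])
    using nz by (simp add: stein_deriv_def stein_solution_def field_simps)
qed

text \<open>Centering at \<open>h x\<close> instead of the mean allows the pointwise bound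
  \<open>\<bar>h t - h x\<bar> \<le> \<bar>t - x\<bar>\<close>, whose integrals over the half-lines
  are the excesses. The solution and its derivative become linear in \<open>L\<close> and
  \<open>R\<close>, with explicit Gaussian coefficients.\<close>

lemma stein_representation:
  fixes x :: real
  defines "L \<equiv> LBINT t:{..x}. (h t - h x) * std_normal_density t"
  defines "R \<equiv> LBINT t:{x<..}. (h t - h x) * std_normal_density t"
  shows "\<bar>L\<bar> \<le> lower_excess x" "\<bar>R\<bar> \<le> upper_excess x"
    "normal_mean = h x + L + R"
    "stein_solution x * std_normal_density x = upper_tail x * L - lower_tail x * R"
proof -
  note int = set_integrable_of_integrable[OF integrable_lipschitz_density]
  note intm = integrable_density_monomials[THEN set_integrable_of_integrable]
  have "\<bar>L\<bar> \<le> (LBINT t:{..x}. \<bar>(h t - h x) * std_normal_density t\<bar>)"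
    unfolding L_def using set_integral_norm_bound[OF int[of "{..x}"]] by simp
  also have "\<dots> \<le> (LBINT t:{..x}. x * std_normal_density t - t * std_normal_density t)"
  proof (rule set_integral_mono)
    show "\<bar>(h t - h x) * std_normal_density t\<bar> \<le> x * std_normal_density t - t * std_normal_density t" if "t \<in> {..x}" for t
      using lipschitz_diff_le[of t x] that mult_right_mono[of "\<bar>h t - h x\<bar>" "x - t" "std_normal_density t"]
      by (simp only: abs_mult) (simp add: algebra_simps)
  qed (use int[THEN set_integrable_abs] intm in \<open>auto intro!: set_integral_diff set_integrable_mult_right\<close>)
  also have "\<dots> = lower_excess x"
    by (simp add: set_integral_diff intm lower_excess_def set_integral_mult_right lower_tail_moment1
        flip: lower_tail_def)
  finally show "\<bar>L\<bar> \<le> lower_excess x" .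
  have "\<bar>R\<bar> \<le> (LBINT t:{x<..}. \<bar>(h t - h x) * std_normal_density t\<bar>)"
    unfolding R_def using set_integral_norm_bound[OF int[of "{x<..}"]] by simp
  also have "\<dots> \<le> (LBINT t:{x<..}. t * std_normal_density t - x * std_normal_density t)"
  proof (rule set_integral_mono)
    show "\<bar>(h t - h x) * std_normal_density t\<bar> \<le> t * std_normal_density t - x * std_normal_density t" if "t \<in> {x<..}" for t
      using lipschitz_diff_le[of t x] that mult_right_mono[of "\<bar>h t - h x\<bar>" "t - x" "std_normal_density t"]
      by (simp only: abs_mult) (simp add: algebra_simps)
  qed (use int[THEN set_integrable_abs] intm in \<open>auto intro!: set_integral_diff set_integrable_mult_right\<close>)
  also have "\<dots> = upper_excess x"
    by (simp add: set_integral_diff intm upper_excess_def set_integral_mult_right upper_tail_moment1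
        flip: upper_tail_def)
  finally show "\<bar>R\<bar> \<le> upper_excess x" .
  have "L + R = (LBINT t. (h t - h x) * std_normal_density t)"
    unfolding L_def R_def by (intro integral_atMost_add_greaterThan integrable_lipschitz_density)
  also have "\<dots> = (LBINT t. h t * std_normal_density t - h x * std_normal_density t)"
    by (simp add: algebra_simps)
  also have "\<dots> = normal_mean - h x"
    using integrable_lipschitz_density[of 0] integrable_density_monomials(1)
    by (simp add: normal_mean_def integral_density_monomials)
  finally show nm: "normal_mean = h x + L + R" by simp
  have "stein_solution x * std_normal_density x = (LBINT t:{..x}. (h t - normal_mean) * std_normal_density t)"
    using std_normal_density_pos[of x] by (simp add: stein_solution_def)
  also have "\<dots> = (LBINT t:{..x}. (h t - h x) * std_normal_density t + (h x - normal_mean) * std_normal_density t)"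
    by (simp add: algebra_simps)
  also have "\<dots> = L + (h x - normal_mean) * lower_tail x"
    unfolding L_def lower_tail_def
    by (subst set_integral_add) (auto simp: int intm set_integral_mult_right intro!: set_integrable_mult_right)
  \<comment> \<open>Here \<open>h x - normal_mean\<close> is \<open>- (L + R)\<close>, and
    \<open>L\<close> is multiplied by the total mass 1 of the two tails, so that the terms
    \<open>L * lower_tail x\<close> cancel.\<close>
  also have "\<dots> = L * (lower_tail x + upper_tail x) - (L + R) * lower_tail x"
    by (simp add: nm lower_add_upper_tail algebra_simps)
  finally show "stein_solution x * std_normal_density x = upper_tail x * L - lower_tail x * R"
    by (simp add: algebra_simps)
qed

text \<open>After multiplication by the density, each of \<open>L\<close> and \<open>R\<close> is
  paired with the opposite excess. The bound is therefore twice the product of the excesses, which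
  \<open>excess_prod_le\<close> controls with constant exactly 1.\<close>

lemma abs_stein_deriv_le: "\<bar>stein_deriv x\<bar> \<le> 1"
proof -
  let ?p = "std_normal_density x"
  define L where "L = (LBINT t:{..x}. (h t - h x) * std_normal_density t)"
  define R where "R = (LBINT t:{x<..}. (h t - h x) * std_normal_density t)"
  note rep = stein_representation[of x, folded L_def R_def]
  have "stein_deriv x * ?p = x * (stein_solution x * ?p) - (L + R) * ?p"
    by (simp add: stein_deriv_def rep(3) algebra_simps)
  also have "\<dots> = - (L * upper_excess x + R * lower_excess x)"
    by (simp add: rep(4) upper_excess_def lower_excess_def algebra_simps)
  finally have "\<bar>stein_deriv x * ?p\<bar> \<le> lower_excess x * upper_excess x + upper_excess x * lower_excess x"
    using abs_linear_combination_le(2)[OF rep(1,2) excess_nonneg(2)[of x] excess_nonneg(1)[of x]] by simp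
  also have "\<dots> \<le> 1 * ?p" using excess_prod_le[of x] by simp
  finally have "\<bar>stein_deriv x\<bar> * ?p \<le> 1 * ?p" by (simp add: abs_mult)
  then show ?thesis using std_normal_density_pos[of x] by (simp only: mult_le_cancel_right_pos)
qed

lemma abs_stein_product_deriv_le: "\<bar>stein_solution x + x * stein_deriv x\<bar> \<le> 1"
proof -
  let ?p = "std_normal_density x"
  let ?U = "(1 + x\<^sup>2) * upper_tail x - x * ?p" and ?V = "(1 + x\<^sup>2) * lower_tail x + x * ?p"
  define L where "L = (LBINT t:{..x}. (h t - h x) * std_normal_density t)"
  define R where "R = (LBINT t:{x<..}. (h t - h x) * std_normal_density t)"
  note rep = stein_representation[of x, folded L_def R_def]
  have u: "upper_tail x = 1 - lower_tail x" using lower_add_upper_tail[of x] by simp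
  have "(stein_solution x + x * stein_deriv x) * ?p = (1 + x\<^sup>2) * (stein_solution x * ?p) - x * (L + R) * ?p"
    by (simp add: stein_deriv_def rep(3) algebra_simps power2_eq_square)
  also have "\<dots> = L * ?U - R * ?V"
    by (simp add: rep(4) algebra_simps)
  finally have "\<bar>(stein_solution x + x * stein_deriv x) * ?p\<bar> \<le> lower_excess x * ?U + upper_excess x * ?V"
    using abs_linear_combination_le(1)[OF rep(1,2) second_excess_nonneg(2)[of x] second_excess_nonneg(1)[of x]] by simp
  \<comment> \<open>An exact identity, not an estimate: the terms containing products of tails
    cancel, leaving \<open>(1 + x\<^sup>2) * ?p - x\<^sup>2 * ?p\<close>.\<close>
  also have "\<dots> = 1 * ?p"
    unfolding u lower_excess_def upper_excess_def by algebra
  finally have "\<bar>stein_solution x + x * stein_deriv x\<bar> * ?p \<le> 1 * ?p" by (simp add: abs_mult)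
  then show ?thesis using std_normal_density_pos[of x] by (simp only: mult_le_cancel_right_pos)
qed

text \<open>By the Stein equation the increment of \<open>stein_deriv\<close> is that of
  \<open>x * stein_solution x\<close> plus that of \<open>h\<close>; each contributes 1 to the
  constant 2.\<close>

lemma lipschitz_stein_deriv: "\<bar>stein_deriv y - stein_deriv x\<bar> \<le> 2 * \<bar>y - x\<bar>"
proof -
  have "((\<lambda>x. x * stein_solution x) has_real_derivative stein_solution z + z * stein_deriv z) (at z)" for z
    by (auto intro!: derivative_eq_intros DERIV_stein_solution)
  then have "\<bar>y * stein_solution y - x * stein_solution x\<bar> \<le> 1 * \<bar>y - x\<bar>"
    using field_differentiable_bound[of UNIV "\<lambda>x. x * stein_solution x" "\<lambda>x. stein_solution x + x * stein_deriv x" 1 y x]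
    by (simp add: abs_stein_product_deriv_le)
  moreover have "stein_deriv y - stein_deriv x = (y * stein_solution y - x * stein_solution x) + (h y - h x)"
    by (simp add: stein_deriv_def)
  ultimately have "\<bar>stein_deriv y - stein_deriv x\<bar> \<le> 1 * \<bar>y - x\<bar> + \<bar>y - x\<bar>"
    using lipschitz_diff_le[of y x] by (metis abs_triangle_ineq add_mono order_trans)
  then show ?thesis by simp
qed

end

section \<open>Taylor remainders and the symmetrized kernel\<close>

lemma first_order_taylor_bound:
  fixes f f' :: "real \<Rightarrow> real"
  assumes D: "\<And>x. (f has_real_derivative f' x) (at x)" and lip: "\<And>x y. \<bar>f' x - f' y\<bar> \<le> K * \<bar>x - y\<bar>"
  shows "\<bar>f (a + d) - f a - d * f' a\<bar> \<le> K * d\<^sup>2 / 2"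
proof -
  have "f (a + d) - f a - d * f' a \<le> K * d\<^sup>2 / 2"
    if D: "\<And>x. (f has_real_derivative f' x) (at x)" and lip: "\<And>x y. \<bar>f' x - f' y\<bar> \<le> K * \<bar>x - y\<bar>"
    for f f' :: "real \<Rightarrow> real"
  proof -
    \<comment> \<open>The derivative \<open>f'\<close> is only Lipschitz, so the remainder is
      controlled by monotonicity along the segment from \<open>a\<close> to \<open>a + d\<close>.
      The quadratic term is chosen so that the Lipschitz bound makes \<open>?g\<close>
      nonincreasing; the reverse estimate follows from the same argument for
      \<open>- f\<close>.\<close>
    let ?g = "\<lambda>t. f (a + t * d) - t * d * f' a - K * d\<^sup>2 * t\<^sup>2 / 2"
    have "?g 1 \<le> ?g 0"
    proof (rule DERIV_nonpos_imp_nonincreasing[of 0 1])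
      fix t :: real assume t: "0 \<le> t" "t \<le> 1"
      have "(?g has_real_derivative d * (f' (a + t * d) - f' a) - K * d\<^sup>2 * t) (at t)"
        by (auto intro!: derivative_eq_intros DERIV_chain2[OF D] simp: algebra_simps)
      moreover have "d * (f' (a + t * d) - f' a) \<le> K * d\<^sup>2 * t"
      proof -
        have "d * (f' (a + t * d) - f' a) \<le> \<bar>d\<bar> * \<bar>f' (a + t * d) - f' a\<bar>"
          by (metis abs_ge_self abs_mult)
        also have "\<dots> \<le> \<bar>d\<bar> * (K * \<bar>t * d\<bar>)"
          using lip[of "a + t * d" a] by (intro mult_left_mono) auto
        also have "\<dots> = K * d\<^sup>2 * t" using t by (simp add: abs_mult power2_eq_square)
        finally show ?thesis .
      qed
      ultimately show "\<exists>y. (?g has_real_derivative y) (at t) \<and> y \<le> 0" by (meson diff_le_0_iff_le)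
    qed simp
    then show ?thesis by simp
  qed
  note upper = this
  have "- f (a + d) - - f a - d * - f' a \<le> K * d\<^sup>2 / 2"
  proof (rule upper)
    show "((\<lambda>x. - f x) has_real_derivative - f' x) (at x)" for x by (rule DERIV_minus[OF D])
    show "\<bar>- f' x - - f' y\<bar> \<le> K * \<bar>x - y\<bar>" for x y using lip[of x y] by linarith
  qed
  with upper[OF D lip] show ?thesis by linarith
qed

lemma stein_kernel_bound:
  fixes f f' :: "real \<Rightarrow> real"
  assumes "\<And>x. (f has_real_derivative f' x) (at x)" and "\<And>x y. \<bar>f' x - f' y\<bar> \<le> K * \<bar>x - y\<bar>"
  shows "\<bar>(x - y) * (f x - f y + y * f' x - x * f' y)\<bar> \<le> K / 2 * (\<bar>x\<bar> + \<bar>y\<bar>) * (x\<^sup>2 + y\<^sup>2)"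
proof -
  have "\<bar>f x - f y + y * f' x - x * f' y\<bar> \<le> K * x\<^sup>2 / 2 + K * y\<^sup>2 / 2"
    \<comment> \<open>One expansion at \<open>y\<close> with increment \<open>x\<close>, one at
      \<open>x\<close> with increment \<open>y\<close>: the common value \<open>f (x + y)\<close>
      cancels in their difference.\<close>
    using first_order_taylor_bound[of f f' K y x, OF assms] first_order_taylor_bound[of f f' K x y, OF assms]
    unfolding add.commute[of y x] by linarith
  then have "\<bar>x - y\<bar> * \<bar>f x - f y + y * f' x - x * f' y\<bar> \<le> (\<bar>x\<bar> + \<bar>y\<bar>) * (K * x\<^sup>2 / 2 + K * y\<^sup>2 / 2)"
    by (intro mult_mono) auto
  also have "(\<bar>x\<bar> + \<bar>y\<bar>) * (K * x\<^sup>2 / 2 + K * y\<^sup>2 / 2) = K / 2 * (\<bar>x\<bar> + \<bar>y\<bar>) * (x\<^sup>2 + y\<^sup>2)"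
    by (simp add: field_simps)
  finally show ?thesis by (simp only: abs_mult)
qed

section \<open>Moment bounds and the Stein discrepancy of one centered law\<close>

lemma power_le_one_plus_power:
  fixes a :: real
  assumes "0 \<le> a" "m \<le> n"
  shows "a ^ m \<le> 1 + a ^ n"
proof (cases "a \<le> 1")
  case True
  then show ?thesis using assms power_le_one[of a m] zero_le_power[of a n] by linarith
next
  case False
  then show ?thesis using assms power_increasing[of m n a] by linarith
qed

context prob_space begin

lemma integrable_abs_power_le:
  fixes X :: "'a \<Rightarrow> real"
  assumes "integrable M (\<lambda>\<omega>. \<bar>X \<omega>\<bar> ^ n)" "m \<le> n" "X \<in> borel_measurable M"
  shows "integrable M (\<lambda>\<omega>. \<bar>X \<omega>\<bar> ^ m)"
proof (rule Bochner_Integration.integrable_bound)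
  show "integrable M (\<lambda>\<omega>. 1 + \<bar>X \<omega>\<bar> ^ n)" using assms(1) by simp
  show "AE \<omega> in M. norm (\<bar>X \<omega>\<bar> ^ m) \<le> norm (1 + \<bar>X \<omega>\<bar> ^ n)"
    using power_le_one_plus_power[OF abs_ge_zero assms(2)] by (auto simp: power_abs)
qed (use assms(3) in measurable)

end

lemma DERIV_abs_le:
  fixes f f' :: "real \<Rightarrow> real"
  assumes "\<And>x. (f has_real_derivative f' x) (at x)" and "\<And>x. \<bar>f' x\<bar> \<le> 1"
  shows "\<bar>f x\<bar> \<le> \<bar>f 0\<bar> + \<bar>x\<bar>"
  using field_differentiable_bound[of UNIV f f' 1 x 0] assms by auto

lemma DERIV_borel_measurable:
  fixes f f' :: "real \<Rightarrow> real"
  assumes "\<And>x. (f has_real_derivative f' x) (at x)"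
  shows "f \<in> borel_measurable borel"
  using assms by (intro borel_measurable_continuous_onI continuous_at_imp_continuous_on) (auto intro: DERIV_isCont)

lemma lipschitz_borel_measurable:
  fixes g :: "real \<Rightarrow> real"
  assumes "\<And>x y. \<bar>g x - g y\<bar> \<le> K * \<bar>x - y\<bar>"
  shows "g \<in> borel_measurable borel"
proof -
  have "K \<ge> 0" using assms[of 1 0] by simp
  then have "K-lipschitz_on UNIV g" using assms by (intro lipschitz_onI) (auto simp: dist_real_def)
  then show ?thesis by (intro borel_measurable_continuous_onI lipschitz_on_continuous_on)
qed

lemma stein_discrepancy_bound:
  fixes \<mu> :: "real measure" and f f' :: "real \<Rightarrow> real"
  assumes \<mu>: "prob_space \<mu>" "sets \<mu> = sets borel" and third: "integrable \<mu> (\<lambda>x. \<bar>x\<bar> ^ 3)" and mean: "(\<integral>x. x \<partial>\<mu>) = 0"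
    and D: "\<And>x. (f has_real_derivative f' x) (at x)" and lip: "\<And>x y. \<bar>f' x - f' y\<bar> \<le> K * \<bar>x - y\<bar>"
    and bd: "\<And>x. \<bar>f' x\<bar> \<le> 1"
  shows "\<bar>(\<integral>x. x\<^sup>2 \<partial>\<mu>) * (\<integral>x. f' x \<partial>\<mu>) - (\<integral>x. x * f x \<partial>\<mu>)\<bar>
     \<le> K / 2 * ((\<integral>x. \<bar>x\<bar> ^ 3 \<partial>\<mu>) + (\<integral>x. \<bar>x\<bar> \<partial>\<mu>) * (\<integral>x. x\<^sup>2 \<partial>\<mu>))"
proof -
  interpret prob_space \<mu> by fact
  note [measurable_cong] = \<mu>(2)
  note [measurable] = DERIV_borel_measurable[OF D] lipschitz_borel_measurable[OF lip]
  have i1: "integrable \<mu> (\<lambda>x. \<bar>x\<bar>)" and i2: "integrable \<mu> (\<lambda>x. x\<^sup>2)"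
    using integrable_abs_power_le[OF third, of 1] integrable_abs_power_le[OF third, of 2] by auto
  then have i1': "integrable \<mu> (\<lambda>x. x)" by (simp add: integrable_abs_iff)
  have if': "integrable \<mu> f'" by (rule integrable_const_bound[of _ 1]) (auto simp: bd)
  have if0: "integrable \<mu> f"
    by (rule Bochner_Integration.integrable_bound[of _ "\<lambda>x. \<bar>f 0\<bar> + \<bar>x\<bar>"])
      (use i1 DERIV_abs_le[OF D bd] in \<open>auto\<close>)
  have ixf': "integrable \<mu> (\<lambda>x. x * f' x)"
    by (rule Bochner_Integration.integrable_bound[of _ "\<lambda>x. \<bar>x\<bar>"])
      (use i1 bd in \<open>auto simp: abs_mult intro!: mult_left_le\<close>)
  have ixf: "integrable \<mu> (\<lambda>x. x * f x)"
  proof (rule Bochner_Integration.integrable_bound[of _ "\<lambda>x. \<bar>f 0\<bar> * \<bar>x\<bar> + x\<^sup>2"])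
    have "\<bar>x\<bar> * \<bar>f x\<bar> \<le> \<bar>f 0\<bar> * \<bar>x\<bar> + x\<^sup>2" for x
      using mult_left_mono[OF DERIV_abs_le[OF D bd, of x], of "\<bar>x\<bar>"] by (simp add: algebra_simps power2_eq_square)
    then show "AE x in \<mu>. norm (x * f x) \<le> norm (\<bar>f 0\<bar> * \<bar>x\<bar> + x\<^sup>2)" by (auto simp: abs_mult)
  qed (use i1 i2 in auto)
  define k where "k = (\<lambda>x y. (x - y) * (f x - f y + y * f' x - x * f' y))"
  define b where "b = (\<lambda>x y::real. K / 2 * (\<bar>x\<bar> + \<bar>y\<bar>) * (x\<^sup>2 + y\<^sup>2))"
  note ints = i1 i2 i1' if' if0 ixf' ixf third
  let ?E = "integral\<^sup>L \<mu>"
  \<comment> \<open>The expansion separates the variables, so the double integral over the two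
    independent copies can be computed as an iterated integral without a product measure.\<close>
  have k_eq: "k x y = x * f x - x * f y + (x * f' x) * y - x\<^sup>2 * f' y - f x * y + y * f y - f' x * y\<^sup>2 + x * (y * f' y)" for x y
    unfolding k_def by (simp add: algebra_simps power2_eq_square)
  have b_eq: "b x y = K / 2 * \<bar>x\<bar> ^ 3 + K / 2 * x\<^sup>2 * \<bar>y\<bar> + K / 2 * \<bar>x\<bar> * y\<^sup>2 + K / 2 * \<bar>y\<bar> ^ 3" for x y
    unfolding b_def by (simp add: algebra_simps power2_eq_square power3_eq_cube)
  have k_int: "integrable \<mu> (k x)" and b_int: "integrable \<mu> (b x)" for x
    unfolding k_eq[abs_def] b_eq[abs_def] using ints by auto
  have Ek: "?E (k x) = x * f x - x * ?E f - x\<^sup>2 * ?E f' + ?E (\<lambda>y. y * f y) - f' x * ?E (\<lambda>y. y\<^sup>2) + x * ?E (\<lambda>y. y * f' y)" for x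
    unfolding k_eq[abs_def] using ints by (simp add: mean prob_space)
  have Eb: "?E (b x) = K / 2 * \<bar>x\<bar> ^ 3 + K / 2 * x\<^sup>2 * ?E abs + K / 2 * \<bar>x\<bar> * ?E (\<lambda>y. y\<^sup>2) + K / 2 * ?E (\<lambda>y. \<bar>y\<bar> ^ 3)" for x
    unfolding b_eq[abs_def] using ints by (simp add: prob_space)
  have Ek_int: "integrable \<mu> (\<lambda>x. ?E (k x))" and Eb_int: "integrable \<mu> (\<lambda>x. ?E (b x))"
    unfolding Ek Eb using ints by auto
  \<comment> \<open>Centering kills every term in which \<open>x\<close> or \<open>y\<close> occurs
    as a separate linear factor. The remaining terms pair up by symmetry, and the resulting 2 turns
    the factor \<open>K\<close> of \<open>EEb\<close> into \<open>K / 2\<close>.\<close>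
  have EEk: "?E (\<lambda>x. ?E (k x)) = 2 * (?E (\<lambda>x. x * f x) - ?E (\<lambda>x. x\<^sup>2) * ?E f')"
    unfolding Ek using ints by (simp add: mean prob_space)
  have EEb: "?E (\<lambda>x. ?E (b x)) = K * (?E (\<lambda>x. \<bar>x\<bar> ^ 3) + ?E abs * ?E (\<lambda>x. x\<^sup>2))"
    unfolding Eb using ints by (simp add: prob_space algebra_simps)
  have kb: "\<bar>k x y\<bar> \<le> b x y" for x y
    unfolding k_def b_def by (rule stein_kernel_bound[OF D lip])
  have "\<bar>?E (\<lambda>x. ?E (k x))\<bar> \<le> ?E (\<lambda>x. ?E (b x))"
  proof (rule order_trans[OF integral_abs_bound integral_mono])
    fix x show "\<bar>?E (k x)\<bar> \<le> ?E (b x)"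
      by (rule order_trans[OF integral_abs_bound integral_mono]) (use kb k_int b_int in auto)
  qed (use Ek_int Eb_int in auto)
  then show ?thesis unfolding EEk EEb by argo
qed

section \<open>Adding an independent summand\<close>

context prob_space begin

text \<open>This is conditioning on \<open>U\<close>: independence makes the joint law the product
  of the marginals, and Fubini applies.\<close>

lemma integral_indep_var_iterated:
  fixes U X :: "'a \<Rightarrow> real" and F :: "real \<times> real \<Rightarrow> real"
  assumes ind: "indep_var borel U borel X" and [measurable]: "F \<in> borel_measurable (borel \<Otimes>\<^sub>M borel)"
    and int: "integrable M (\<lambda>\<omega>. F (U \<omega>, X \<omega>))"
  shows "integrable (distr M borel U) (\<lambda>u. \<integral>x. F (u, x) \<partial>distr M borel X)"
    and "(\<integral>\<omega>. F (U \<omega>, X \<omega>) \<partial>M) = (\<integral>u. \<integral>x. F (u, x) \<partial>distr M borel X \<partial>distr M borel U)"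
proof -
  have [measurable]: "U \<in> borel_measurable M" "X \<in> borel_measurable M"
    using ind by (auto dest: indep_var_rv1 indep_var_rv2)
  interpret U: prob_space "distr M borel U" by (rule prob_space_distr) simp
  interpret X: prob_space "distr M borel X" by (rule prob_space_distr) simp
  interpret P: pair_sigma_finite "distr M borel U" "distr M borel X" ..
  have eq: "distr M borel U \<Otimes>\<^sub>M distr M borel X = distr M (borel \<Otimes>\<^sub>M borel) (\<lambda>\<omega>. (U \<omega>, X \<omega>))"
    using ind by (simp add: indep_var_distribution_eq)
  have int': "integrable (distr M borel U \<Otimes>\<^sub>M distr M borel X) F"
    unfolding eq using int by (simp add: integrable_distr_eq)
  show "integrable (distr M borel U) (\<lambda>u. \<integral>x. F (u, x) \<partial>distr M borel X)"
    by (rule P.integrable_fst'[OF int'])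
  have "(\<integral>\<omega>. F (U \<omega>, X \<omega>) \<partial>M) = integral\<^sup>L (distr M borel U \<Otimes>\<^sub>M distr M borel X) F"
    unfolding eq by (simp add: integral_distr)
  also have "\<dots> = (\<integral>u. \<integral>x. F (u, x) \<partial>distr M borel X \<partial>distr M borel U)"
    by (rule P.integral_fst'[OF int', symmetric])
  finally show "(\<integral>\<omega>. F (U \<omega>, X \<omega>) \<partial>M) = (\<integral>u. \<integral>x. F (u, x) \<partial>distr M borel X \<partial>distr M borel U)" .
qed

lemma integrable_mult_square_integrable:
  fixes U X :: "'a \<Rightarrow> real"
  assumes "integrable M (\<lambda>\<omega>. (U \<omega>)\<^sup>2)" "integrable M (\<lambda>\<omega>. (X \<omega>)\<^sup>2)"
    and [measurable]: "U \<in> borel_measurable M" "X \<in> borel_measurable M"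
  shows "integrable M (\<lambda>\<omega>. U \<omega> * X \<omega>)"
proof (rule Bochner_Integration.integrable_bound)
  show "integrable M (\<lambda>\<omega>. (U \<omega>)\<^sup>2 + (X \<omega>)\<^sup>2)" using assms by simp
  have "\<bar>a * b\<bar> \<le> a\<^sup>2 + b\<^sup>2" for a b :: real
  proof -
    have "0 \<le> (\<bar>a\<bar> - \<bar>b\<bar>)\<^sup>2" by simp
    also have "\<dots> = a\<^sup>2 + b\<^sup>2 - 2 * \<bar>a * b\<bar>" by (simp add: power2_diff abs_mult)
    finally show ?thesis by linarith
  qed
  then show "AE \<omega> in M. norm (U \<omega> * X \<omega>) \<le> norm ((U \<omega>)\<^sup>2 + (X \<omega>)\<^sup>2)" by auto
qed measurable

text \<open>For fixed \<open>u\<close>, the shifted function \<open>f (u + x)\<close> has a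
  derivative with the same bound and the same Lipschitz constant. The one-variable estimate is thus
  uniform in \<open>u\<close> and survives integration over the law of \<open>U\<close>.\<close>

lemma stein_discrepancy_indep:
  fixes U X :: "'a \<Rightarrow> real" and f f' :: "real \<Rightarrow> real"
  assumes ind: "indep_var borel U borel X"
    and U2: "integrable M (\<lambda>\<omega>. (U \<omega>)\<^sup>2)" and third: "integrable M (\<lambda>\<omega>. \<bar>X \<omega>\<bar> ^ 3)" and mean: "expectation X = 0"
    and D: "\<And>x. (f has_real_derivative f' x) (at x)" and lip: "\<And>x y. \<bar>f' x - f' y\<bar> \<le> K * \<bar>x - y\<bar>"
    and bd: "\<And>x. \<bar>f' x\<bar> \<le> 1"
  shows "integrable M (\<lambda>\<omega>. X \<omega> * f (U \<omega> + X \<omega>))"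
    and "\<bar>expectation (\<lambda>\<omega>. (X \<omega>)\<^sup>2) * expectation (\<lambda>\<omega>. f' (U \<omega> + X \<omega>)) - expectation (\<lambda>\<omega>. X \<omega> * f (U \<omega> + X \<omega>))\<bar>
     \<le> K / 2 * (expectation (\<lambda>\<omega>. \<bar>X \<omega>\<bar> ^ 3) + expectation (\<lambda>\<omega>. \<bar>X \<omega>\<bar>) * expectation (\<lambda>\<omega>. (X \<omega>)\<^sup>2))"
proof -
  have [measurable]: "U \<in> borel_measurable M" "X \<in> borel_measurable M"
    using ind by (auto dest: indep_var_rv1 indep_var_rv2)
  note [measurable] = DERIV_borel_measurable[OF D] lipschitz_borel_measurable[OF lip]
  interpret U: prob_space "distr M borel U" by (rule prob_space_distr) simp
  interpret X: prob_space "distr M borel X" by (rule prob_space_distr) simp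
  have X1: "integrable M (\<lambda>\<omega>. \<bar>X \<omega>\<bar>)" and X2: "integrable M (\<lambda>\<omega>. (X \<omega>)\<^sup>2)"
    using integrable_abs_power_le[OF third, of 1] integrable_abs_power_le[OF third, of 2] by auto
  have UX: "integrable M (\<lambda>\<omega>. U \<omega> * X \<omega>)"
    by (intro integrable_mult_square_integrable U2 X2) auto
  show int: "integrable M (\<lambda>\<omega>. X \<omega> * f (U \<omega> + X \<omega>))"
  proof (rule Bochner_Integration.integrable_bound)
    show "integrable M (\<lambda>\<omega>. \<bar>f 0\<bar> * \<bar>X \<omega>\<bar> + \<bar>U \<omega> * X \<omega>\<bar> + (X \<omega>)\<^sup>2)" using X1 X2 UX by auto
    have "\<bar>x\<bar> * \<bar>f (u + x)\<bar> \<le> \<bar>f 0\<bar> * \<bar>x\<bar> + \<bar>u * x\<bar> + x\<^sup>2" for u x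
    proof -
      have "\<bar>f (u + x)\<bar> \<le> \<bar>f 0\<bar> + \<bar>u\<bar> + \<bar>x\<bar>" using DERIV_abs_le[OF D bd, of "u + x"] by linarith
      from mult_left_mono[OF this, of "\<bar>x\<bar>"] show ?thesis by (simp add: algebra_simps abs_mult power2_eq_square)
    qed
    then show "AE \<omega> in M. norm (X \<omega> * f (U \<omega> + X \<omega>)) \<le> norm (\<bar>f 0\<bar> * \<bar>X \<omega>\<bar> + \<bar>U \<omega> * X \<omega>\<bar> + (X \<omega>)\<^sup>2)"
      by (auto simp: abs_mult)
  qed measurable
  have intf': "integrable M (\<lambda>\<omega>. f' (U \<omega> + X \<omega>))" by (rule integrable_const_bound[of _ 1]) (auto simp: bd)
  define s where "s = expectation (\<lambda>\<omega>. (X \<omega>)\<^sup>2)"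
  define B where "B = K / 2 * (expectation (\<lambda>\<omega>. \<bar>X \<omega>\<bar> ^ 3) + expectation (\<lambda>\<omega>. \<bar>X \<omega>\<bar>) * s)"
  \<comment> \<open>Both expectations of the claim are combined into one function, with the constant
    \<open>s\<close> as the second moment of \<open>X\<close>; integrating out \<open>x\<close>
    leaves the one-variable discrepancy of the shifted function.\<close>
  define F where "F = (\<lambda>(u, x). s * f' (u + x) - x * f (u + x))"
  have [measurable]: "F \<in> borel_measurable (borel \<Otimes>\<^sub>M borel)" unfolding F_def by measurable
  have intF: "integrable M (\<lambda>\<omega>. F (U \<omega>, X \<omega>))" unfolding F_def using int intf' by simp
  have inner: "\<bar>\<integral>x. F (u, x) \<partial>distr M borel X\<bar> \<le> B" for u
  proof -
    have "(f has_real_derivative f' (u + x)) (at (u + x))" for x by (rule D)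
    then have Du: "((\<lambda>x. f (u + x)) has_real_derivative f' (u + x)) (at x)" for x
      using DERIV_shift[of f "f' (u + x)" x u for x] by (simp only: add.commute[of u])
    have ifx': "integrable (distr M borel X) (\<lambda>x. f' (u + x))"
      by (rule X.integrable_const_bound[of _ 1]) (auto simp: bd)
    have ifx: "integrable (distr M borel X) (\<lambda>x. x * f (u + x))"
    proof (rule Bochner_Integration.integrable_bound[of _ "\<lambda>x. \<bar>f u\<bar> * \<bar>x\<bar> + x\<^sup>2"])
      show "integrable (distr M borel X) (\<lambda>x. \<bar>f u\<bar> * \<bar>x\<bar> + x\<^sup>2)" 
        using X1 X2 by (auto simp: integrable_distr_eq)
      have "\<bar>x\<bar> * \<bar>f (u + x)\<bar> \<le> \<bar>f u\<bar> * \<bar>x\<bar> + x\<^sup>2" for x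
        using mult_left_mono[OF DERIV_abs_le[OF Du bd, of x], of "\<bar>x\<bar>"] by (simp add: algebra_simps power2_eq_square)
      then show "AE x in distr M borel X. norm (x * f (u + x)) \<le> norm (\<bar>f u\<bar> * \<bar>x\<bar> + x\<^sup>2)" by (auto simp: abs_mult)
    qed auto
    have "\<bar>(\<integral>x. x\<^sup>2 \<partial>distr M borel X) * (\<integral>x. f' (u + x) \<partial>distr M borel X) - (\<integral>x. x * f (u + x) \<partial>distr M borel X)\<bar>
     \<le> K / 2 * ((\<integral>x. \<bar>x\<bar> ^ 3 \<partial>distr M borel X) + (\<integral>x. \<bar>x\<bar> \<partial>distr M borel X) * (\<integral>x. x\<^sup>2 \<partial>distr M borel X))"
      by (rule stein_discrepancy_bound[OF X.prob_space_axioms _ _ _ Du])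
        (use third mean bd lip[of "u + x" "u + y" for x y] in \<open>auto simp: integrable_distr_eq integral_distr\<close>)
    then show ?thesis using ifx ifx' by (simp add: F_def B_def s_def integral_distr)
  qed
  have "\<bar>expectation (\<lambda>\<omega>. F (U \<omega>, X \<omega>))\<bar> \<le> (\<integral>u. \<bar>\<integral>x. F (u, x) \<partial>distr M borel X\<bar> \<partial>distr M borel U)"
    unfolding integral_indep_var_iterated(2)[OF ind \<open>F \<in> _\<close> intF] by (rule integral_abs_bound)
  also have "\<dots> \<le> (\<integral>u. B \<partial>distr M borel U)"
    using integral_indep_var_iterated(1)[OF ind \<open>F \<in> _\<close> intF] inner by (intro integral_mono) auto
  also have "\<dots> = B" using U.prob_space by simp
  finally show "\<bar>expectation (\<lambda>\<omega>. (X \<omega>)\<^sup>2) * expectation (\<lambda>\<omega>. f' (U \<omega> + X \<omega>)) - expectation (\<lambda>\<omega>. X \<omega> * f (U \<omega> + X \<omega>))\<bar>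
     \<le> K / 2 * (expectation (\<lambda>\<omega>. \<bar>X \<omega>\<bar> ^ 3) + expectation (\<lambda>\<omega>. \<bar>X \<omega>\<bar>) * expectation (\<lambda>\<omega>. (X \<omega>)\<^sup>2))"
    using int intf' by (simp add: F_def B_def s_def)
qed

end

section \<open>Sums of independent centered variables\<close>

context prob_space begin

lemma square_integrable_sum:
  fixes X :: "'i \<Rightarrow> 'a \<Rightarrow> real"
  assumes "finite J" "\<And>i. i \<in> J \<Longrightarrow> integrable M (\<lambda>\<omega>. (X i \<omega>)\<^sup>2)" "\<And>i. i \<in> J \<Longrightarrow> X i \<in> borel_measurable M"
  shows "integrable M (\<lambda>\<omega>. (\<Sum>i\<in>J. X i \<omega>)\<^sup>2)"
  using assms
proof (induction J rule: finite_induct)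
  case (insert i J)
  then have "integrable M (\<lambda>\<omega>. X i \<omega> * (\<Sum>i\<in>J. X i \<omega>))"
    by (intro integrable_mult_square_integrable) auto
  with insert show ?case by (simp add: power2_sum mult.assoc)
qed simp

lemma indep_var_commute: "indep_var S X T Y \<longleftrightarrow> indep_var T Y S X"
proof -
  have "indep_set A B \<Longrightarrow> indep_set B A" for A B
    unfolding indep_sets2_eq by (metis Int_commute mult.commute)
  then show ?thesis unfolding indep_var_eq by blast
qed

text \<open>Each \<open>X i\<close> is paired with the leave-one-out sum \<open>U i\<close>, which
  is independent of it, and the single-summand estimates are added. The second moments add up to
  that of \<open>W\<close>, so its deviation from 1 accounts for the first term.\<close>

lemma stein_discrepancy_sum:
  fixes X :: "'i \<Rightarrow> 'a \<Rightarrow> real" and f f' :: "real \<Rightarrow> real"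
  assumes fin: "finite I" and ind: "indep_vars (\<lambda>_. borel) X I"
    and third: "\<And>i. i \<in> I \<Longrightarrow> integrable M (\<lambda>\<omega>. \<bar>X i \<omega>\<bar> ^ 3)"
    and mean: "\<And>i. i \<in> I \<Longrightarrow> expectation (X i) = 0"
    and D: "\<And>x. (f has_real_derivative f' x) (at x)" and lip: "\<And>x y. \<bar>f' x - f' y\<bar> \<le> K * \<bar>x - y\<bar>"
    and bd: "\<And>x. \<bar>f' x\<bar> \<le> 1"
  defines "W \<equiv> \<lambda>\<omega>. \<Sum>i\<in>I. X i \<omega>"
  shows "integrable M (\<lambda>\<omega>. W \<omega> * f (W \<omega>))"
    and "\<bar>expectation (\<lambda>\<omega>. f' (W \<omega>)) - expectation (\<lambda>\<omega>. W \<omega> * f (W \<omega>))\<bar>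
      \<le> \<bar>1 - expectation (\<lambda>\<omega>. (W \<omega>)\<^sup>2)\<bar> + K / 2 * (\<Sum>i\<in>I. expectation (\<lambda>\<omega>. \<bar>X i \<omega>\<bar> ^ 3) +
          expectation (\<lambda>\<omega>. \<bar>X i \<omega>\<bar>) * expectation (\<lambda>\<omega>. (X i \<omega>)\<^sup>2))"
proof -
  have meas: "X i \<in> borel_measurable M" if "i \<in> I" for i
    using ind that by (auto simp: indep_vars_def)
  have sq: "integrable M (\<lambda>\<omega>. (X i \<omega>)\<^sup>2)" if "i \<in> I" for i
    using integrable_abs_power_le[OF third[OF that], of 2] meas[OF that] by simp
  define U where "U i \<omega> = (\<Sum>j\<in>I - {i}. X j \<omega>)" for i \<omega>
  have W_eq: "W \<omega> = U i \<omega> + X i \<omega>" if "i \<in> I" for i \<omega>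
    using fin that by (simp add: W_def U_def sum.remove add.commute)
  have U2: "integrable M (\<lambda>\<omega>. (U i \<omega>)\<^sup>2)" for i
    unfolding U_def using fin sq meas by (intro square_integrable_sum) auto
  have UX: "indep_var borel (U i) borel (X i)" if "i \<in> I" for i
  proof -
    have "indep_var borel (X i) borel (\<lambda>\<omega>. \<Sum>j\<in>I - {i}. X j \<omega>)"
      using fin that ind by (intro indep_vars_sum) (auto simp: insert_absorb)
    then show ?thesis by (simp add: indep_var_commute U_def[abs_def])
  qed
  let ?s = "\<lambda>i. expectation (\<lambda>\<omega>. (X i \<omega>)\<^sup>2)"
  have step: "integrable M (\<lambda>\<omega>. X i \<omega> * g (W \<omega>))"
    "\<bar>?s i * expectation (\<lambda>\<omega>. g' (W \<omega>)) - expectation (\<lambda>\<omega>. X i \<omega> * g (W \<omega>))\<bar>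
      \<le> L / 2 * (expectation (\<lambda>\<omega>. \<bar>X i \<omega>\<bar> ^ 3) + expectation (\<lambda>\<omega>. \<bar>X i \<omega>\<bar>) * ?s i)"
    if i: "i \<in> I" and g: "\<And>x. (g has_real_derivative g' x) (at x)"
      "\<And>x y. \<bar>g' x - g' y\<bar> \<le> L * \<bar>x - y\<bar>" "\<And>x. \<bar>g' x\<bar> \<le> 1" for i g g' L
    unfolding W_eq[OF i] by (rule stein_discrepancy_indep[OF UX[OF i] U2 third[OF i] mean[OF i] g])+
  \<comment> \<open>With \<open>g\<close> the identity, the Lipschitz constant of \<open>g'\<close>
    is 0, so the discrepancy bound becomes an equality and yields the additivity of the second
    moments.\<close>
  have XW: "integrable M (\<lambda>\<omega>. X i \<omega> * W \<omega>)" "expectation (\<lambda>\<omega>. X i \<omega> * W \<omega>) = ?s i" if i: "i \<in> I" for i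
    using step[OF i, of "\<lambda>x. x" "\<lambda>_. 1" 0] by (simp_all add: prob_space)
  have "expectation (\<lambda>\<omega>. (W \<omega>)\<^sup>2) = expectation (\<lambda>\<omega>. \<Sum>i\<in>I. X i \<omega> * W \<omega>)"
    by (simp add: W_def power2_eq_square sum_distrib_right)
  also have "\<dots> = (\<Sum>i\<in>I. ?s i)" using XW by simp
  finally have W2: "expectation (\<lambda>\<omega>. (W \<omega>)\<^sup>2) = (\<Sum>i\<in>I. ?s i)" .
  have XfW: "integrable M (\<lambda>\<omega>. X i \<omega> * f (W \<omega>))"
    "\<bar>?s i * expectation (\<lambda>\<omega>. f' (W \<omega>)) - expectation (\<lambda>\<omega>. X i \<omega> * f (W \<omega>))\<bar>
      \<le> K / 2 * (expectation (\<lambda>\<omega>. \<bar>X i \<omega>\<bar> ^ 3) + expectation (\<lambda>\<omega>. \<bar>X i \<omega>\<bar>) * ?s i)" if i: "i \<in> I" for i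
    by (rule step[OF i D lip bd])+
  have WfW: "W \<omega> * f (W \<omega>) = (\<Sum>i\<in>I. X i \<omega> * f (W \<omega>))" for \<omega>
    by (simp add: W_def sum_distrib_right)
  show "integrable M (\<lambda>\<omega>. W \<omega> * f (W \<omega>))"
    unfolding WfW using XfW(1) by (intro Bochner_Integration.integrable_sum)
  let ?e = "expectation (\<lambda>\<omega>. f' (W \<omega>))"
  have e: "\<bar>?e\<bar> \<le> 1"
  proof -
    have [measurable]: "W \<in> borel_measurable M" unfolding W_def using meas by measurable
    note [measurable] = lipschitz_borel_measurable[OF lip]
    have "integrable M (\<lambda>\<omega>. f' (W \<omega>))" by (rule integrable_const_bound[of _ 1]) (auto simp: bd)
    then have "expectation (\<lambda>\<omega>. \<bar>f' (W \<omega>)\<bar>) \<le> expectation (\<lambda>_. 1)"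
      by (intro integral_mono) (auto simp: bd)
    then show ?thesis
      using order_trans[OF integral_abs_bound[of M "\<lambda>\<omega>. f' (W \<omega>)"]] by (simp add: prob_space)
  qed
  have EWfW: "expectation (\<lambda>\<omega>. W \<omega> * f (W \<omega>)) = (\<Sum>i\<in>I. expectation (\<lambda>\<omega>. X i \<omega> * f (W \<omega>)))"
    unfolding WfW by (rule Bochner_Integration.integral_sum[OF XfW(1)])
  \<comment> \<open>The quantity \<open>(\<Sum>i\<in>I. ?s i) * ?e\<close> is added and subtracted.
    The first summand is bounded through \<open>\<bar>?e\<bar> \<le> 1\<close>, the second term by
    term.\<close>
  have split: "?e - expectation (\<lambda>\<omega>. W \<omega> * f (W \<omega>)) = (1 - (\<Sum>i\<in>I. ?s i)) * ?e +
      (\<Sum>i\<in>I. ?s i * ?e - expectation (\<lambda>\<omega>. X i \<omega> * f (W \<omega>)))"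
    unfolding EWfW sum_subtractf sum_distrib_right[symmetric] by (simp only: left_diff_distrib mult_1)
  have "\<bar>(1 - (\<Sum>i\<in>I. ?s i)) * ?e\<bar> \<le> \<bar>1 - (\<Sum>i\<in>I. ?s i)\<bar>"
    unfolding abs_mult by (rule mult_left_le[OF e abs_ge_zero])
  moreover have "\<bar>\<Sum>i\<in>I. ?s i * ?e - expectation (\<lambda>\<omega>. X i \<omega> * f (W \<omega>))\<bar>
      \<le> K / 2 * (\<Sum>i\<in>I. expectation (\<lambda>\<omega>. \<bar>X i \<omega>\<bar> ^ 3) + expectation (\<lambda>\<omega>. \<bar>X i \<omega>\<bar>) * ?s i)"
    unfolding sum_distrib_left by (rule order_trans[OF sum_abs sum_mono]) (rule XfW(2))
  ultimately show "\<bar>?e - expectation (\<lambda>\<omega>. W \<omega> * f (W \<omega>))\<bar>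
      \<le> \<bar>1 - expectation (\<lambda>\<omega>. (W \<omega>)\<^sup>2)\<bar> + K / 2 * (\<Sum>i\<in>I. expectation (\<lambda>\<omega>. \<bar>X i \<omega>\<bar> ^ 3) +
          expectation (\<lambda>\<omega>. \<bar>X i \<omega>\<bar>) * ?s i)"
    unfolding split W2 by (rule order_trans[OF abs_triangle_ineq add_mono])
qed

text \<open>The Stein equation is evaluated at the sum and integrated. The Lipschitz constant 2 of
  \<open>stein_deriv\<close> makes the factor \<open>K / 2\<close> equal to 1.\<close>

lemma lipschitz_normal_approximation:
  fixes X :: "'i \<Rightarrow> 'a \<Rightarrow> real" and h :: "real \<Rightarrow> real"
  assumes fin: "finite I" and ind: "indep_vars (\<lambda>_. borel) X I"
    and third: "\<And>i. i \<in> I \<Longrightarrow> integrable M (\<lambda>\<omega>. \<bar>X i \<omega>\<bar> ^ 3)"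
    and mean: "\<And>i. i \<in> I \<Longrightarrow> expectation (X i) = 0"
    and lip: "1-lipschitz_on UNIV h"
  shows "\<bar>expectation (\<lambda>\<omega>. h (\<Sum>i\<in>I. X i \<omega>)) - (LBINT t. h t * std_normal_density t)\<bar>
      \<le> \<bar>1 - expectation (\<lambda>\<omega>. (\<Sum>i\<in>I. X i \<omega>)\<^sup>2)\<bar> + (\<Sum>i\<in>I. expectation (\<lambda>\<omega>. \<bar>X i \<omega>\<bar> ^ 3) +
          expectation (\<lambda>\<omega>. \<bar>X i \<omega>\<bar>) * expectation (\<lambda>\<omega>. (X i \<omega>)\<^sup>2))"
proof -
  define W where "W \<omega> = (\<Sum>i\<in>I. X i \<omega>)" for \<omega>
  define f f' where "f = stein_solution h" and "f' = stein_deriv h"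
  have D: "(f has_real_derivative f' x) (at x)" and bd: "\<bar>f' x\<bar> \<le> 1"
    and lip': "\<bar>f' x - f' y\<bar> \<le> 2 * \<bar>x - y\<bar>" for x y
    unfolding f_def f'_def
    using DERIV_stein_solution[OF lip] abs_stein_deriv_le[OF lip] lipschitz_stein_deriv[OF lip] by auto
  note [measurable] = lipschitz_borel_measurable[OF lip']
  have "\<And>i. i \<in> I \<Longrightarrow> X i \<in> borel_measurable M" using ind by (auto simp: indep_vars_def)
  then have [measurable]: "W \<in> borel_measurable M" unfolding W_def[abs_def] by measurable
  have "integrable M (\<lambda>\<omega>. f' (W \<omega>))" by (rule integrable_const_bound[of _ 1]) (auto simp: bd)
  note bound = stein_discrepancy_sum[OF fin ind third mean D lip' bd, folded W_def]
  have "h (W \<omega>) = f' (W \<omega>) - W \<omega> * f (W \<omega>) + normal_mean h" for \<omega>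
    by (simp add: f_def f'_def stein_deriv_def[OF lip])
  then have "expectation (\<lambda>\<omega>. h (W \<omega>)) - normal_mean h = expectation (\<lambda>\<omega>. f' (W \<omega>)) - expectation (\<lambda>\<omega>. W \<omega> * f (W \<omega>))"
    using bound(1) \<open>integrable M (\<lambda>\<omega>. f' (W \<omega>))\<close> by (simp add: prob_space)
  with bound(2) show ?thesis by (simp add: W_def normal_mean_def[OF lip])
qed

end

section \<open>The Wasserstein bound, including infinite third moments\<close>

theorem proposition4p2:
  fixes M :: "'a measure" and N :: "'b measure"
    and X :: "nat \<Rightarrow> 'a \<Rightarrow> real" and Y :: "'b \<Rightarrow> real"
    and F :: "nat \<Rightarrow> real \<Rightarrow> real" and n :: nat
  assumes "prob_space M" and "prob_space N"
    and "prob_space.indep_vars M (\<lambda>_. borel) X {1..}"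
    and "\<And>k. k \<ge> 1 \<Longrightarrow> integrable M (X k)"
    and "\<And>k. k \<ge> 1 \<Longrightarrow> (\<integral>\<omega>. X k \<omega> \<partial>M) = 0"
    and "\<And>k. k \<ge> 1 \<Longrightarrow> F k = cdf (distr M borel (X k))"
    and "quantile_step_fun F \<in> C1_box \<inter> L2_halfline"
    and "distributed N lborel Y (\<lambda>x. ennreal (std_normal_density x))"
    and "n \<ge> 1"
  shows "wasserstein_dist M (\<lambda>\<omega>. \<Sum>k=1..n. X k \<omega>) N Y
    \<le> ennreal \<bar>1 - (\<integral>\<omega>. (\<Sum>k=1..n. X k \<omega>)\<^sup>2 \<partial>M)\<bar>
      + (\<Sum>k=1..n. \<integral>\<^sup>+\<omega>. ennreal (\<bar>X k \<omega>\<bar> ^ 3) \<partial>M)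
      + (\<Sum>k=1..n. (\<integral>\<^sup>+\<omega>. ennreal \<bar>X k \<omega>\<bar> \<partial>M) * (\<integral>\<^sup>+\<omega>. ennreal (\<bar>X k \<omega>\<bar>\<^sup>2) \<partial>M))"
proof -
  interpret prob_space M by fact
  have meas: "X k \<in> borel_measurable M" if "k \<ge> 1" for k
    using assms(4)[OF that] by auto
  show ?thesis
  proof (cases "\<forall>k\<in>{1..n}. integrable M (\<lambda>\<omega>. \<bar>X k \<omega>\<bar> ^ 3)")
    case False
    then obtain k where k: "k \<in> {1..n}" "\<not> integrable M (\<lambda>\<omega>. \<bar>X k \<omega>\<bar> ^ 3)" by blast
    then have "(\<integral>\<^sup>+\<omega>. ennreal (\<bar>X k \<omega>\<bar> ^ 3) \<partial>M) = \<infinity>"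
      using meas[of k] by (auto simp: integrable_iff_bounded less_top[symmetric])
    with k(1) have top: "(\<Sum>k=1..n. \<integral>\<^sup>+\<omega>. ennreal (\<bar>X k \<omega>\<bar> ^ 3) \<partial>M) = \<infinity>"
      using member_le_sum[of k "{1..n}" "\<lambda>k. \<integral>\<^sup>+\<omega>. ennreal (\<bar>X k \<omega>\<bar> ^ 3) \<partial>M"] by (auto simp: top_unique)
    show ?thesis unfolding top by simp
  next
    case True
    \<comment> \<open>Finite third moments make the lower moments finite too, so all extended
      nonnegative integrals in the bound are real expectations, and the estimate can be carried out
      over the reals.\<close>
    have nn: "(\<integral>\<^sup>+\<omega>. ennreal (\<bar>X k \<omega>\<bar> ^ m) \<partial>M) = ennreal (expectation (\<lambda>\<omega>. \<bar>X k \<omega>\<bar> ^ m))"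
      if "k \<in> {1..n}" "m \<le> 3" for k m
      using integrable_abs_power_le[of "X k" 3 m] True that meas[of k] by (intro nn_integral_eq_integral) auto
    have ind: "indep_vars (\<lambda>_. borel) X {1..n}"
      by (rule indep_vars_subset[OF assms(3)]) auto
    let ?b = "\<bar>1 - expectation (\<lambda>\<omega>. (\<Sum>k=1..n. X k \<omega>)\<^sup>2)\<bar> + (\<Sum>k=1..n. expectation (\<lambda>\<omega>. \<bar>X k \<omega>\<bar> ^ 3) +
          expectation (\<lambda>\<omega>. \<bar>X k \<omega>\<bar>) * expectation (\<lambda>\<omega>. (X k \<omega>)\<^sup>2))"
    have "wasserstein_dist M (\<lambda>\<omega>. \<Sum>k=1..n. X k \<omega>) N Y \<le> ennreal ?b"
      unfolding wasserstein_dist_def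
    proof (rule SUP_least)
      fix h :: "real \<Rightarrow> real" assume "h \<in> {h. 1-lipschitz_on UNIV h}"
      then have lip: "1-lipschitz_on UNIV h" by simp
      \<comment> \<open>The law of \<open>Y\<close> enters only through its density, so its
        probability space disappears and the expectation becomes the Gaussian mean of the Stein
        equation.\<close>
      have "(\<integral>\<omega>. h (Y \<omega>) \<partial>N) = (LBINT t. std_normal_density t * h t)"
        by (rule distributed_integral[OF assms(8), symmetric])
          (use lip in \<open>auto intro!: borel_measurable_continuous_onI lipschitz_on_continuous_on\<close>)
      also have "\<dots> = (LBINT t. h t * std_normal_density t)" by (simp add: mult.commute)
      finally show "ennreal \<bar>expectation (\<lambda>\<omega>. h (\<Sum>k=1..n. X k \<omega>)) - (\<integral>\<omega>. h (Y \<omega>) \<partial>N)\<bar> \<le> ennreal ?b"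
        using lipschitz_normal_approximation[OF _ ind _ _ lip] True assms(5) by (intro ennreal_leI) simp
    qed
    also have "ennreal ?b = ennreal \<bar>1 - expectation (\<lambda>\<omega>. (\<Sum>k=1..n. X k \<omega>)\<^sup>2)\<bar>
      + (\<Sum>k=1..n. ennreal (expectation (\<lambda>\<omega>. \<bar>X k \<omega>\<bar> ^ 3)))
      + (\<Sum>k=1..n. ennreal (expectation (\<lambda>\<omega>. \<bar>X k \<omega>\<bar>)) * ennreal (expectation (\<lambda>\<omega>. \<bar>X k \<omega>\<bar>\<^sup>2)))"
      by (simp add: sum.distrib sum_nonneg add.assoc sum_ennreal flip: ennreal_mult)
    also have "\<dots> = ennreal \<bar>1 - (\<integral>\<omega>. (\<Sum>k=1..n. X k \<omega>)\<^sup>2 \<partial>M)\<bar>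
      + (\<Sum>k=1..n. \<integral>\<^sup>+\<omega>. ennreal (\<bar>X k \<omega>\<bar> ^ 3) \<partial>M)
      + (\<Sum>k=1..n. (\<integral>\<^sup>+\<omega>. ennreal \<bar>X k \<omega>\<bar> \<partial>M) * (\<integral>\<^sup>+\<omega>. ennreal (\<bar>X k \<omega>\<bar>\<^sup>2) \<partial>M))"
      using nn[of _ 3] nn[of _ 1] nn[of _ 2] by simp
    finally show ?thesis .
  qed
qed

end
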